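(* Let $k,\nu>0$ and let $m\in\mathbb{N}\cup\{0\}$. Then for $0<x<y$, $$\frac{\Psi_{k,\nu}^{(2m)}(x)+\Psi_{k,\nu}^{(2m)}(y)}{2}\leq \frac{\Psi_{k,\nu}^{(2m-1)}(y)-\Psi_{k,\nu}^{(2m-1)}(x)}{y-x}$$ and $$\frac{\Psi_{k,\nu}^{(2m)}(y)-\Psi_{k,\nu}^{(2m)}(x)}{y-x}\leq\frac{\Psi_{k,\nu}^{(2m+1)}(x)+\Psi_{k,\nu}^{(2m+1)}(y)}{2}.$$
   Context: For $k>0$, $\nu>0$, the $(k,\nu)$ Gamma function is defined (here for $x>0$) by $$\Gamma_{k,\nu}(x)=\lim_{n\to\infty}\frac{n!\,(k\nu)^n\left(\frac{nk}{\nu}\right)^{\frac{x}{k\nu}-1}}{(x)_{n,k\nu}},$$ where for $a\in\mathbb{R}$ and $n\in\mathbb{N}$, $(x)_{n,a}=x(x+a)\cdots(x+(n-1)a)$. The $(k,\nu)$ psi (digamma) function is $\Psi_{k,\nu}(x)=\frac{d}{dx}\ln\Gamma_{k,\nu}(x)$. For an integer $m>0$, $\Psi_{k,\nu}^{(m)}$ denotes the $m$-th derivative of $\Psi_{k,\nu}$ with respect to $x$; moreover $\Psi_{k,\nu}^{(0)}=\Psi_{k,\nu}$ and $\Psi_{k,\nu}^{(-1)}=\ln\Gamma_{k,\nu}$. *)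

theory Defs
  imports "HOL-Analysis.Analysis"
begin

definition pochhammer_step :: "real \<Rightarrow> nat \<Rightarrow> real \<Rightarrow> real" where
  "pochhammer_step x n a = (\<Prod>i<n. x + real i * a)"

text \<open>Intended for \<open>k > 0\<close>, \<open>\<nu> > 0\<close>, \<open>x > 0\<close>.\<close>

definition Gamma_k\<nu> :: "real \<Rightarrow> real \<Rightarrow> real \<Rightarrow> real" where
  "Gamma_k\<nu> k \<nu> x =
     lim (\<lambda>n. fact n * (k * \<nu>) ^ n * (real n * k / \<nu>) powr (x / (k * \<nu>) - 1)
              / pochhammer_step x n (k * \<nu>))"

definition Psi_k\<nu> :: "real \<Rightarrow> real \<Rightarrow> real \<Rightarrow> real" where
  "Psi_k\<nu> k \<nu> = deriv (\<lambda>x. ln (Gamma_k\<nu> k \<nu> x))"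

text \<open>The order of differentiation is an integer \<open>\<ge> -1\<close>, order \<open>-1\<close> being by convention
  the logarithm of the Gamma function; orders below \<open>-1\<close> carry no meaning.\<close>

definition Psi_k\<nu>_deriv :: "real \<Rightarrow> real \<Rightarrow> int \<Rightarrow> real \<Rightarrow> real" where
  "Psi_k\<nu>_deriv k \<nu> j =
     (if j = -1 then (\<lambda>x. ln (Gamma_k\<nu> k \<nu> x)) else (deriv ^^ nat j) (Psi_k\<nu> k \<nu>))"

end

theory Submission
  imports Defs
begin

text \<open>
  Both inequalities are the trapezoid half of the Hermite--Hadamard inequality: over an interval,
  the mean value of a convex function is at most the average of its two end values, and the reverse
  holds for a concave function. When the function is the derivative of some \<open>F\<close>, its mean value
  over \<open>[x, y]\<close> is the difference quotient of \<open>F\<close>, which is how the inequality appears in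
  \<open>convex_trapezoid\<close> and \<open>concave_trapezoid\<close>.

  What remains is to know that, on the positive axis, each \<open>\<Psi>\<^sub>k\<^sub>\<nu>\<^sup>(\<^sup>j\<^sup>)\<close> is an antiderivative of the
  next one, that those of odd order are convex and that those of even order are concave. Substituting
  \<open>z = x / (k\<nu>)\<close> in the limit that defines \<open>\<Gamma>\<^sub>k\<^sub>\<nu>(x)\<close> turns it into the classical limit for
  \<open>\<Gamma>(z)\<close>, up to a factor \<open>(k / \<nu>)\<^sup>z\<^sup>-\<^sup>1\<close> (\<open>Gamma_k\<nu>_eq_Gamma\<close>). Hence \<open>ln \<Gamma>\<^sub>k\<^sub>\<nu>\<close> is
  \<open>ln \<Gamma>(z)\<close> plus an affine function, and its derivatives are polygamma functions of \<open>z\<close> with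
  positive scaling factors, except for a constant in the first one (\<open>Psi_k\<nu>_deriv_eq_Polygamma\<close>).
  The curvature in order \<open>j\<close> is the sign in order \<open>j + 2\<close>, and \<open>j + 2\<close> is at least \<open>2\<close>
  here, so that constant is gone and the alternating signs of the polygamma functions decide.
\<close>

section \<open>The trapezoid inequality for antiderivatives\<close>

text \<open>
  Convexity puts the derivative of \<open>G\<close> below the chord through its end values. So \<open>G\<close> minus an
  antiderivative of that chord is nonincreasing, and comparing its values at the two ends gives
  the claim, because the integral of the chord is the area of the trapezoid.
\<close>

lemma convex_trapezoid:
  fixes G g :: "real \<Rightarrow> real"
  assumes "x < y" and convex: "convex_on {x..y} g"
    and deriv: "\<And>t. t \<in> {x..y} \<Longrightarrow> (G has_real_derivative g t) (at t)"
  shows "(G y - G x) / (y - x) \<le> (g x + g y) / 2"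
proof -
  define s where "s = (g y - g x) / (y - x)"
  define H where "H t = G t - (s * (t - x)\<^sup>2 / 2 + g x * t)" for t
  have "H y \<le> H x"
  proof (rule DERIV_nonpos_imp_nonincreasing[where f = H])
    fix t assume t: "x \<le> t" "t \<le> y"
    have "(H has_real_derivative g t - (s * (t - x) + g x)) (at t)"
      unfolding H_def using t by (auto intro!: derivative_eq_intros deriv)
    moreover have "g t - (s * (t - x) + g x) \<le> 0"
      using convex_onD_Icc'[OF convex, of t] t by (simp add: s_def)
    ultimately show "\<exists>D. (H has_real_derivative D) (at t) \<and> D \<le> 0"
      by blast
  qed (use \<open>x < y\<close> in simp)
  moreover have "s * (y - x)\<^sup>2 = (g y - g x) * (y - x)"
    using \<open>x < y\<close> by (simp add: s_def power2_eq_square)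
  ultimately have "G y - G x \<le> (g x + g y) / 2 * (y - x)"
    by (simp add: H_def field_simps)
  then show ?thesis
    using \<open>x < y\<close> by (simp add: pos_divide_le_eq)
qed

lemma concave_trapezoid:
  fixes G g :: "real \<Rightarrow> real"
  assumes "x < y" and concave: "concave_on {x..y} g"
    and deriv: "\<And>t. t \<in> {x..y} \<Longrightarrow> (G has_real_derivative g t) (at t)"
  shows "(g x + g y) / 2 \<le> (G y - G x) / (y - x)"
proof -
  have "convex_on {x..y} (\<lambda>t. - g t)"
    using concave by (simp add: concave_on_def)
  moreover have "((\<lambda>t. - G t) has_real_derivative - g t) (at t)" if "t \<in> {x..y}" for t
    using that by (intro derivative_intros deriv)
  ultimately have "(- G y - - G x) / (y - x) \<le> (- g x + - g y) / 2"
    by (rule convex_trapezoid[OF \<open>x < y\<close>])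
  then show ?thesis
    by (simp add: diff_divide_distrib add_divide_distrib)
qed

section \<open>Reduction to the classical Gamma function\<close>

lemma pochhammer_step_eq_pochhammer:
  assumes "c \<noteq> 0"
  shows "pochhammer_step x n c = c ^ n * pochhammer (x / c) n"
proof -
  have "pochhammer_step x n c = (\<Prod>i<n. c * (x / c + real i))"
    unfolding pochhammer_step_def using assms by (intro prod.cong) (auto simp: field_simps)
  also have "\<dots> = c ^ n * pochhammer (x / c) n"
    by (simp add: prod.distrib pochhammer_prod lessThan_atLeast0)
  finally show ?thesis .
qed

text \<open>
  After cancelling \<open>(k\<nu>)\<^sup>n\<close>, the \<open>n\<close>-th approximant of \<open>\<Gamma>\<^sub>k\<^sub>\<nu>(x)\<close> equals, for \<open>n > 0\<close>, the
  \<open>n\<close>-th term \<open>(n - 1)! n\<^sup>z / (z)\<^sub>n\<close> of a classical sequence for \<open>\<Gamma>(z)\<close>, times a constant.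
\<close>

lemma Gamma_k\<nu>_eq_Gamma:
  assumes "k > 0" "\<nu> > 0" "x > 0"
  shows "Gamma_k\<nu> k \<nu> x = (k / \<nu>) powr (x / (k * \<nu>) - 1) * Gamma (x / (k * \<nu>))"
proof -
  define z where "z = x / (k * \<nu>)"
  have "z > 0"
    using assms by (simp add: z_def)
  have "(\<lambda>n. (k / \<nu>) powr (z - 1) * Gamma_series' z n)
          \<longlonglongrightarrow> (k / \<nu>) powr (z - 1) * Gamma z"
    by (intro tendsto_intros Gamma_series'_LIMSEQ)
  moreover have "eventually (\<lambda>n. (k / \<nu>) powr (z - 1) * Gamma_series' z n =
      fact n * (k * \<nu>) ^ n * (real n * k / \<nu>) powr (z - 1) / pochhammer_step x n (k * \<nu>))
      sequentially"
    using eventually_gt_at_top[of 0]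
  proof eventually_elim
    case (elim n)
    have poch: "pochhammer_step x n (k * \<nu>) = (k * \<nu>) ^ n * pochhammer z n"
      using assms by (simp add: pochhammer_step_eq_pochhammer z_def)
    have "(real n * k / \<nu>) powr (z - 1) = (real n * (k / \<nu>)) powr (z - 1)"
      by simp
    also have "\<dots> = real n powr (z - 1) * (k / \<nu>) powr (z - 1)"
      using assms by (subst powr_mult) auto
    also have "real n powr (z - 1) = exp (z * ln (real n)) / real n"
      using elim by (simp add: powr_diff) (simp add: powr_def)
    finally have pow: "(real n * k / \<nu>) powr (z - 1) =
        exp (z * ln (real n)) / real n * (k / \<nu>) powr (z - 1)" .
    have "fact n = real n * (fact (n - 1) :: real)"
      using elim by (simp add: fact_reduce)
    then show ?case
      unfolding poch pow Gamma_series'_def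
      using assms elim by (simp add: field_simps)
  qed
  ultimately have "(\<lambda>n. fact n * (k * \<nu>) ^ n * (real n * k / \<nu>) powr (z - 1)
      / pochhammer_step x n (k * \<nu>)) \<longlonglongrightarrow> (k / \<nu>) powr (z - 1) * Gamma z"
    by (rule Lim_transform_eventually)
  then show ?thesis
    unfolding Gamma_k\<nu>_def z_def by (rule limI)
qed

lemma ln_Gamma_k\<nu>_eq:
  assumes "k > 0" "\<nu> > 0" "x > 0"
  shows "ln (Gamma_k\<nu> k \<nu> x) = (x / (k * \<nu>) - 1) * ln (k / \<nu>) + ln_Gamma (x / (k * \<nu>))"
proof -
  have "Gamma (x / (k * \<nu>)) > 0"
    using assms by simp
  moreover have "(k / \<nu>) powr (x / (k * \<nu>) - 1) > 0"
    using assms by simp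
  ultimately show ?thesis
    using assms by (simp add: Gamma_k\<nu>_eq_Gamma ln_mult_pos ln_powr ln_Gamma_real_pos)
qed

section \<open>Derivatives of the generalised digamma function\<close>

lemma eventually_pos_nhds:
  fixes x :: real
  assumes "x > 0" and "\<And>t. t > 0 \<Longrightarrow> P t"
  shows "eventually P (nhds x)"
  using eventually_nhds_in_open[of "{0<..}" x] assms by (auto elim: eventually_mono)

lemma ln_Gamma_k\<nu>_has_derivative:
  assumes "k > 0" "\<nu> > 0" "x > 0"
  shows "((\<lambda>x. ln (Gamma_k\<nu> k \<nu> x)) has_real_derivative
           (ln (k / \<nu>) + Digamma (x / (k * \<nu>))) / (k * \<nu>)) (at x)"
proof -
  have "((\<lambda>x. (x / (k * \<nu>) - 1) * ln (k / \<nu>) + ln_Gamma (x / (k * \<nu>)))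
          has_real_derivative (ln (k / \<nu>) + Digamma (x / (k * \<nu>))) / (k * \<nu>)) (at x)"
    using assms by (auto intro!: derivative_eq_intros simp: field_simps)
  moreover have "eventually (\<lambda>x. ln (Gamma_k\<nu> k \<nu> x) =
      (x / (k * \<nu>) - 1) * ln (k / \<nu>) + ln_Gamma (x / (k * \<nu>))) (nhds x)"
    using assms by (intro eventually_pos_nhds ln_Gamma_k\<nu>_eq)
  ultimately show ?thesis
    by (simp add: DERIV_cong_ev)
qed

lemma pos_not_nonpos_Int:
  fixes x :: real
  assumes "x > 0"
  shows "x \<notin> \<int>\<^sub>\<le>\<^sub>0"
  using assms by (auto elim!: nonpos_Ints_cases)

lemma scaled_Polygamma_has_derivative:
  fixes a c x :: real
  assumes "c > 0" "x > 0"
  shows "((\<lambda>x. a + Polygamma n (x / c) / c ^ Suc n) has_real_derivative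
           Polygamma (Suc n) (x / c) / c ^ Suc (Suc n)) (at x)"
proof -
  have "x / c \<notin> \<int>\<^sub>\<le>\<^sub>0"
    using assms by (intro pos_not_nonpos_Int) simp
  then show ?thesis
    using assms by (auto intro!: derivative_eq_intros simp: field_simps)
qed

text \<open>
  The affine part of \<open>ln \<Gamma>\<^sub>k\<^sub>\<nu>\<close> survives one differentiation as a constant and then vanishes; the
  chain rule contributes one factor \<open>1 / (k\<nu>)\<close> per derivative.
\<close>

lemma Psi_k\<nu>_deriv_eq_Polygamma:
  assumes "k > 0" "\<nu> > 0" "x > 0"
  shows "Psi_k\<nu>_deriv k \<nu> (int n) x =
           (if n = 0 then ln (k / \<nu>) / (k * \<nu>) else 0)
           + Polygamma n (x / (k * \<nu>)) / (k * \<nu>) ^ Suc n"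
  using \<open>x > 0\<close>
proof (induction n arbitrary: x)
  case 0
  have "Psi_k\<nu> k \<nu> x = (ln (k / \<nu>) + Digamma (x / (k * \<nu>))) / (k * \<nu>)"
    unfolding Psi_k\<nu>_def using assms 0 by (intro DERIV_imp_deriv ln_Gamma_k\<nu>_has_derivative)
  then show ?case
    by (simp add: Psi_k\<nu>_deriv_def add_divide_distrib)
next
  case (Suc n)
  define a where "a = (if n = 0 then ln (k / \<nu>) / (k * \<nu>) else 0)"
  have "Psi_k\<nu>_deriv k \<nu> (int (Suc n)) x = deriv (Psi_k\<nu>_deriv k \<nu> (int n)) x"
    unfolding Psi_k\<nu>_deriv_def nat_int by simp
  also have "\<dots> = deriv (\<lambda>x. a + Polygamma n (x / (k * \<nu>)) / (k * \<nu>) ^ Suc n) x"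
    unfolding a_def using Suc by (intro deriv_cong_ev eventually_pos_nhds) auto
  also have "\<dots> = Polygamma (Suc n) (x / (k * \<nu>)) / (k * \<nu>) ^ Suc (Suc n)"
    using assms Suc.prems by (intro DERIV_imp_deriv scaled_Polygamma_has_derivative) auto
  finally show ?case
    by simp
qed

text \<open>
  Since \<open>deriv\<close> is total, that the iterated \<open>deriv\<close> yields genuine derivatives has to come from
  the closed forms.
\<close>

lemma Psi_k\<nu>_deriv_has_derivative:
  assumes "k > 0" "\<nu> > 0" "x > 0" and "j \<ge> -1"
  shows "(Psi_k\<nu>_deriv k \<nu> j has_real_derivative Psi_k\<nu>_deriv k \<nu> (j + 1) x) (at x)"
proof (cases "j = -1")
  case True
  have "Psi_k\<nu>_deriv k \<nu> 0 x = (ln (k / \<nu>) + Digamma (x / (k * \<nu>))) / (k * \<nu>)"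
    using Psi_k\<nu>_deriv_eq_Polygamma[OF assms(1-3), of 0] by (simp add: add_divide_distrib)
  then show ?thesis
    using True ln_Gamma_k\<nu>_has_derivative[OF assms(1-3)] by (simp add: Psi_k\<nu>_deriv_def)
next
  case False
  then obtain n where j: "j = int n"
    using \<open>j \<ge> -1\<close> nonneg_int_cases[of j] by auto
  define a where "a = (if n = 0 then ln (k / \<nu>) / (k * \<nu>) else 0)"
  have "((\<lambda>x. a + Polygamma n (x / (k * \<nu>)) / (k * \<nu>) ^ Suc n) has_real_derivative
          Psi_k\<nu>_deriv k \<nu> (int (Suc n)) x) (at x)"
    using assms scaled_Polygamma_has_derivative[of "k * \<nu>" x a n]
    by (subst Psi_k\<nu>_deriv_eq_Polygamma) auto
  moreover have "eventually (\<lambda>x. Psi_k\<nu>_deriv k \<nu> (int n) x =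
      a + Polygamma n (x / (k * \<nu>)) / (k * \<nu>) ^ Suc n) (nhds x)"
    unfolding a_def using assms by (intro eventually_pos_nhds Psi_k\<nu>_deriv_eq_Polygamma)
  ultimately show ?thesis
    by (simp add: DERIV_cong_ev j add.commute)
qed

lemma Psi_k\<nu>_deriv_odd_pos:
  assumes "k > 0" "\<nu> > 0" "x > 0" and "odd n"
  shows "Psi_k\<nu>_deriv k \<nu> (int n) x > 0"
proof -
  have "x / (k * \<nu>) \<notin> \<int>\<^sub>\<le>\<^sub>0"
    using assms by (intro pos_not_nonpos_Int) simp
  then have "Polygamma n (x / (k * \<nu>)) > 0"
    using \<open>odd n\<close> by (rule Polygamma_real_odd_pos)
  then show ?thesis
    using assms by (subst Psi_k\<nu>_deriv_eq_Polygamma) auto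
qed

lemma Psi_k\<nu>_deriv_even_neg:
  assumes "k > 0" "\<nu> > 0" "x > 0" and "even n" "n > 0"
  shows "Psi_k\<nu>_deriv k \<nu> (int n) x < 0"
proof -
  have "Polygamma n (x / (k * \<nu>)) < 0"
    using assms by (intro Polygamma_real_even_neg) auto
  then show ?thesis
    using assms by (subst Psi_k\<nu>_deriv_eq_Polygamma) (auto simp: divide_less_0_iff)
qed

lemma Psi_k\<nu>_deriv_odd_convex:
  assumes "k > 0" "\<nu> > 0" "x > 0" and "odd n"
  shows "convex_on {x..y} (Psi_k\<nu>_deriv k \<nu> (int n))"
proof (rule f''_ge0_imp_convex)
  fix t assume "t \<in> {x..y}"
  with \<open>x > 0\<close> have "t > 0" by simp
  then show "(Psi_k\<nu>_deriv k \<nu> (int n) has_real_derivative Psi_k\<nu>_deriv k \<nu> (int n + 1) t) (at t)"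
    and "(Psi_k\<nu>_deriv k \<nu> (int n + 1) has_real_derivative
           Psi_k\<nu>_deriv k \<nu> (int n + 1 + 1) t) (at t)"
    using assms by (intro Psi_k\<nu>_deriv_has_derivative; simp)+
  show "0 \<le> Psi_k\<nu>_deriv k \<nu> (int n + 1 + 1) t"
    using Psi_k\<nu>_deriv_odd_pos[of k \<nu> t "n + 2"] assms \<open>t > 0\<close> by (simp add: add.commute)
qed simp

lemma Psi_k\<nu>_deriv_even_concave:
  assumes "k > 0" "\<nu> > 0" "x > 0" and "even n"
  shows "concave_on {x..y} (Psi_k\<nu>_deriv k \<nu> (int n))"
proof (rule f''_le0_imp_concave)
  fix t assume "t \<in> {x..y}"
  with \<open>x > 0\<close> have "t > 0" by simp
  then show "(Psi_k\<nu>_deriv k \<nu> (int n) has_real_derivative Psi_k\<nu>_deriv k \<nu> (int n + 1) t) (at t)"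
    and "(Psi_k\<nu>_deriv k \<nu> (int n + 1) has_real_derivative
           Psi_k\<nu>_deriv k \<nu> (int n + 1 + 1) t) (at t)"
    using assms by (intro Psi_k\<nu>_deriv_has_derivative; simp)+
  show "Psi_k\<nu>_deriv k \<nu> (int n + 1 + 1) t \<le> 0"
    using Psi_k\<nu>_deriv_even_neg[of k \<nu> t "n + 2"] assms \<open>t > 0\<close> by (simp add: add.commute)
qed simp

section \<open>The inequalities for the generalised digamma function\<close>

theorem proposition3p9:
  fixes k \<nu> x y :: real and m :: nat
  assumes "k > 0" and "\<nu> > 0" and "0 < x" and "x < y"
  shows "(Psi_k\<nu>_deriv k \<nu> (2 * int m) x + Psi_k\<nu>_deriv k \<nu> (2 * int m) y) / 2
           \<le> (Psi_k\<nu>_deriv k \<nu> (2 * int m - 1) y - Psi_k\<nu>_deriv k \<nu> (2 * int m - 1) x) / (y - x)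
       \<and> (Psi_k\<nu>_deriv k \<nu> (2 * int m) y - Psi_k\<nu>_deriv k \<nu> (2 * int m) x) / (y - x)
           \<le> (Psi_k\<nu>_deriv k \<nu> (2 * int m + 1) x + Psi_k\<nu>_deriv k \<nu> (2 * int m + 1) y) / 2"
proof
  show "(Psi_k\<nu>_deriv k \<nu> (2 * int m) x + Psi_k\<nu>_deriv k \<nu> (2 * int m) y) / 2
          \<le> (Psi_k\<nu>_deriv k \<nu> (2 * int m - 1) y - Psi_k\<nu>_deriv k \<nu> (2 * int m - 1) x) / (y - x)"
  proof (rule concave_trapezoid[OF \<open>x < y\<close>])
    show "concave_on {x..y} (Psi_k\<nu>_deriv k \<nu> (2 * int m))"
      using Psi_k\<nu>_deriv_even_concave[OF assms(1-3), of "2 * m"] by simp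
    show "(Psi_k\<nu>_deriv k \<nu> (2 * int m - 1) has_real_derivative
            Psi_k\<nu>_deriv k \<nu> (2 * int m) t) (at t)" if "t \<in> {x..y}" for t
      using Psi_k\<nu>_deriv_has_derivative[of k \<nu> t "2 * int m - 1"] assms that by simp
  qed
next
  show "(Psi_k\<nu>_deriv k \<nu> (2 * int m) y - Psi_k\<nu>_deriv k \<nu> (2 * int m) x) / (y - x)
          \<le> (Psi_k\<nu>_deriv k \<nu> (2 * int m + 1) x + Psi_k\<nu>_deriv k \<nu> (2 * int m + 1) y) / 2"
  proof (rule convex_trapezoid[OF \<open>x < y\<close>])
    show "convex_on {x..y} (Psi_k\<nu>_deriv k \<nu> (2 * int m + 1))"
      using Psi_k\<nu>_deriv_odd_convex[OF assms(1-3), of "2 * m + 1"] by (simp add: add.commute)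
    show "(Psi_k\<nu>_deriv k \<nu> (2 * int m) has_real_derivative
            Psi_k\<nu>_deriv k \<nu> (2 * int m + 1) t) (at t)" if "t \<in> {x..y}" for t
      using assms that by (intro Psi_k\<nu>_deriv_has_derivative) auto
  qed
qed

end
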